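(* There exists a non-increasing function $C:(0,+\infty)\to[1,+\infty)$ such that, for any given $h\in(0,+\infty)$, there is an infinite word $w$ on some finite alphabet such that for any $n\in\mathbb{N}$, $$e^{hn}\le p_w(n)\le C(h)\,e^{hn}.$$
   Context: Here $\mathbb{N}=\{0,1,2,\dots\}$. For an infinite word $w\in A^{\mathbb{N}}$ on a finite alphabet $A$, $p_w(n)$ is the number of distinct words of length $n$ on $A$ that are factors (contiguous subwords) of $w$. The alphabet is allowed to depend on $h$ (it must have at least $\lceil e^h\rceil$ letters). *)

theory Defs
  imports Complex_Main "HOL-Library.FuncSet" "HOL-Library.Omega_Words_Fun"
begin

definition factor :: "'a list \<Rightarrow> 'a word \<Rightarrow> bool" where
  "factor u w \<longleftrightarrow> (\<exists>i j. i \<le> j \<and> u = w [i \<rightarrow> j])"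

text \<open>The alphabet is not a parameter: a factor of a word with letters in \<open>A\<close> is automatically
  a word on \<open>A\<close>. If \<open>A\<close> is finite, the set counted here is finite.\<close>

definition complexity :: "'a word \<Rightarrow> nat \<Rightarrow> nat" where
  "complexity w n = card {u. length u = n \<and> factor u w}"

end

theory Submission
  imports Defs "HOL-Analysis.Lebesgue_Measure"
begin

text \<open>
  Put \<open>\<beta> = exp h > 1\<close>. The word is a point with dense orbit in the \<open>\<beta>\<close>-shift, the
  system that codes the expansions of real numbers in the base \<open>\<beta>\<close>, which need not be an integer.

  Let \<open>T x\<close> be the fractional part of \<open>\<beta> * x\<close> on \<open>[0,1)\<close>, and code \<open>x\<close> by the sequence of
  integer parts of \<open>\<beta> * T^i x\<close>. The points whose code begins with a given word \<open>u\<close> form the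
  cylinder of \<open>u\<close>, and \<open>u\<close> is admissible if its cylinder is nonempty. A nonempty cylinder is a
  half-open interval whose left end is the value of \<open>u\<close> in base \<open>\<beta>\<close> and whose length is at
  most \<open>\<beta>^-n\<close> for \<open>n\<close> the length of \<open>u\<close> (\<open>cylinder_interval\<close>). Everything else is read off
  from this.

  Let \<open>a n\<close> be the number of admissible words of length \<open>n\<close>; their cylinders partition \<open>[0,1)\<close>.
  As each has length at most \<open>\<beta>^-n\<close>, we get \<open>a n \<ge> \<beta>^n\<close>. For the upper bound, call a word full if
  its cylinder attains the length \<open>\<beta>^-n\<close>. There are at most \<open>\<beta>^n\<close> full words of length \<open>n\<close>, as
  their cylinders are disjoint in \<open>[0,1)\<close>. Among the admissible one-letter extensions of a word all
  are full except possibly the one with the largest letter, so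
  \<open>a (n + 1) \<le> a n + \<beta>^(n + 1)\<close>, and hence \<open>a n \<le> 1 + \<beta> + ... + \<beta>^n \<le> C(h) * \<beta>^n\<close> with
  \<open>C(h) = 1 / (1 - exp (- h))\<close>, which decreases in \<open>h\<close>.

  It remains to find one infinite word whose factors are exactly the admissible words. Admissibility
  passes to factors, and two admissible words can be joined to a longer admissible word by writing
  enough zeros between them, because a cylinder has positive length to the right of its left end.
  For such a language, a word of this kind is obtained by joining all its members one after the other
  (\<open>irreducible_language_word\<close>).
\<close>

section \<open>Infinite words with a prescribed set of factors\<close>

text \<open>Enumerate the language and join its members successively to an increasing chain of words
  \<open>p n\<close> in \<open>L\<close>. Their limit contains every member of \<open>L\<close>, and each of its factors already occurs in
  some \<open>p n\<close>. Nonempty gaps ensure that the lengths of the \<open>p n\<close> are unbounded, so that the limit is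
  an infinite word.\<close>

lemma irreducible_language_word:
  fixes L :: "'a :: countable list set"
  assumes nonempty: "L \<noteq> {}"
    and factors: "\<And>u v x. u @ v @ x \<in> L \<Longrightarrow> v \<in> L"
    and join: "\<And>u v. u \<in> L \<Longrightarrow> v \<in> L \<Longrightarrow> \<exists>g. g \<noteq> [] \<and> u @ g @ v \<in> L"
  shows "\<exists>w :: 'a word. \<forall>u. factor u w \<longleftrightarrow> u \<in> L"
proof -
  define e where "e = from_nat_into L"
  have e: "e n \<in> L" for n
    unfolding e_def by (rule from_nat_into[OF nonempty])
  obtain g where g: "\<And>u v. u \<in> L \<Longrightarrow> v \<in> L \<Longrightarrow> g u v \<noteq> [] \<and> u @ g u v @ v \<in> L"
    using join by metis
  define p where "p = rec_nat (e 0) (\<lambda>n q. q @ g q (e (Suc n)) @ e (Suc n))"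
  have p0: "p 0 = e 0" and pS: "p (Suc n) = p n @ g (p n) (e (Suc n)) @ e (Suc n)" for n
    by (simp_all add: p_def)
  have pL: "p n \<in> L" for n
    by (induction n) (use e g in \<open>auto simp: p0 pS\<close>)
  have len: "n \<le> length (p n)" for n
  proof (induction n)
    case (Suc n)
    have "0 < length (g (p n) (e (Suc n)))"
      using g[OF pL e] by blast
    then show ?case
      using Suc unfolding pS length_append by linarith
  qed simp
  have chain: "\<exists>r. p n = p m @ r" if "m \<le> n" for m n
    using that by (induction n rule: dec_induct) (auto simp: pS)
  define w :: "'a word" where "w i = p (Suc i) ! i" for i
  have w_nth: "w i = p n ! i" if "i < length (p n)" for i n
  proof -
    have i: "i < length (p (Suc i))"
      using len[of "Suc i"] by simp
    consider "Suc i \<le> n" | "n \<le> Suc i" by linarith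
    then show ?thesis
    proof cases
      case 1
      then obtain r where "p n = p (Suc i) @ r" using chain by blast
      then show ?thesis using i by (simp add: w_def nth_append)
    next
      case 2
      then obtain r where "p (Suc i) = p n @ r" using chain by blast
      then show ?thesis using that by (simp add: w_def nth_append)
    qed
  qed
  have w_sub: "w [i \<rightarrow> j] = take (j - i) (drop i (p n))" if "i \<le> j" "j \<le> length (p n)" for i j n
    using that w_nth by (intro nth_equalityI) (auto simp: subsequence_def)
  have "factor u w \<longleftrightarrow> u \<in> L" for u
  proof
    assume "factor u w"
    then obtain i j where ij: "i \<le> j" "u = w [i \<rightarrow> j]"
      unfolding factor_def by blast
    then have "u = take (j - i) (drop i (p j))"
      using w_sub len by blast
    then have "take i (p j) @ u @ drop (j - i) (drop i (p j)) = p j"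
      by (simp only: append_take_drop_id)
    then show "u \<in> L"
      using factors pL by metis
  next
    assume "u \<in> L"
    then obtain n where n: "u = e n"
      unfolding e_def by (metis countableI_type from_nat_into_surj)
    have "\<exists>r. p n = r @ e n"
      by (cases n) (auto simp: p0 pS intro: exI[of _ "_ @ _"])
    then obtain r where r: "p n = r @ u" using n by blast
    have "u = w [length r \<rightarrow> length (p n)]"
      by (subst w_sub[of _ _ n]) (auto simp: r)
    then show "factor u w"
      unfolding factor_def by (metis r length_append le_add1)
  qed
  then show ?thesis by blast
qed

section \<open>Expansions in a real base\<close>

context
  fixes \<beta> :: real
  assumes beta: "1 < \<beta>"
begin

text \<open>The condition \<open>\<beta> * x - a \<in> cylinder u\<close> forces \<open>\<beta> * x - a \<in> {0..<1}\<close>, so that \<open>a\<close> is the integer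
  part of \<open>\<beta> * x\<close> and \<open>\<beta> * x - a\<close> its fractional part.\<close>

fun cylinder :: "nat list \<Rightarrow> real set" where
  "cylinder [] = {0..<1}"
| "cylinder (a # u) = {x \<in> {0..<1}. \<beta> * x - real a \<in> cylinder u}"

fun base_value :: "nat list \<Rightarrow> real" where
  "base_value [] = 0"
| "base_value (a # u) = (real a + base_value u) / \<beta>"

definition admissible :: "nat list set" where
  "admissible = {u. cylinder u \<noteq> {}}"

definition admissible_of_length :: "nat \<Rightarrow> nat list set" where
  "admissible_of_length n = {u \<in> admissible. length u = n}"

lemma beta_pos: "0 < \<beta>"
  using beta by simp

lemma cylinder_subset: "cylinder u \<subseteq> {0..<1}"
  by (cases u) auto

lemma base_value_nonneg: "0 \<le> base_value u"
  using beta by (induction u) auto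

lemma base_value_append: "base_value (u @ v) = base_value u + base_value v / \<beta> ^ length u"
  using beta by (induction u) (auto simp: field_simps)

lemma base_value_zeros: "base_value (replicate k 0) = 0"
  by (induction k) auto

text \<open>After reading \<open>u\<close>, the point \<open>x\<close> has moved to \<open>\<beta> ^ length u * (x - base_value u)\<close>.\<close>

lemma cylinder_append:
  "x \<in> cylinder (u @ v) \<longleftrightarrow>
    x \<in> cylinder u \<and> \<beta> ^ length u * (x - base_value u) \<in> cylinder v"
proof (induction u arbitrary: x)
  case Nil
  then show ?case using cylinder_subset[of v] by auto
next
  case (Cons a u)
  have "\<beta> * x - real a - base_value u = \<beta> * (x - base_value (a # u))"
    using beta by (simp add: right_diff_distrib)
  then have "\<beta> ^ length u * (\<beta> * x - real a - base_value u)
      = \<beta> ^ length (a # u) * (x - base_value (a # u))"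
    by (simp only: length_Cons power_Suc2 mult.assoc)
  then show ?case
    unfolding append_Cons cylinder.simps mem_Collect_eq Cons.IH by (simp only: conj_assoc)
qed

text \<open>The cylinder of \<open>a # u\<close> is the preimage of the interval for \<open>u\<close> under an affine map of slope
  \<open>\<beta>\<close>, cut off at \<open>1\<close>. The cut only ever shortens it from the right, which is why the left end
  is still the value of the word.\<close>

lemma cylinder_interval:
  assumes "u \<in> admissible"
  shows "\<exists>t. base_value u < t \<and> t \<le> base_value u + 1 / \<beta> ^ length u
    \<and> cylinder u = {base_value u..<t}"
  using assms
proof (induction u)
  case Nil
  then show ?case by (intro exI[of _ 1]) simp
next
  case (Cons a u)
  then have "u \<in> admissible" and ne: "cylinder (a # u) \<noteq> {}"
    by (auto simp: admissible_def)
  then obtain t where t: "base_value u < t" "t \<le> base_value u + 1 / \<beta> ^ length u"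
    "cylinder u = {base_value u..<t}"
    using Cons.IH by blast
  let ?s = "min 1 ((real a + t) / \<beta>)"
  have "x \<in> cylinder (a # u) \<longleftrightarrow> x \<in> {base_value (a # u)..<?s}" for x
  proof -
    have "\<beta> * x - real a \<in> {base_value u..<t} \<longleftrightarrow>
        base_value (a # u) \<le> x \<and> x < (real a + t) / \<beta>"
      using beta by (auto simp: field_simps)
    then show ?thesis
      using base_value_nonneg[of "a # u"] by (auto simp: t(3) simp del: base_value.simps)
  qed
  then have eq: "cylinder (a # u) = {base_value (a # u)..<?s}"
    by blast
  moreover from this ne have "base_value (a # u) < ?s"
    by (metis atLeastLessThan_empty not_le)
  moreover have "?s \<le> base_value (a # u) + 1 / \<beta> ^ length (a # u)"
  proof -
    have "(real a + t) / \<beta> \<le> (real a + (base_value u + 1 / \<beta> ^ length u)) / \<beta>"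
      using t(2) beta_pos by (intro divide_right_mono) auto
    also have "\<dots> = base_value (a # u) + 1 / \<beta> ^ length (a # u)"
      by (simp add: add_divide_distrib)
    finally show ?thesis by simp
  qed
  ultimately show ?case by blast
qed

lemma cylinder_measurable: "cylinder u \<in> sets lborel"
  by (cases "u \<in> admissible") (use cylinder_interval[of u] in \<open>auto simp: admissible_def\<close>)

lemma Nil_admissible: "[] \<in> admissible"
  by (auto simp: admissible_def intro: exI[of _ 0])

lemma admissible_factor:
  assumes "u @ v @ x \<in> admissible"
  shows "v \<in> admissible"
  using assms by (auto simp: admissible_def cylinder_append)

text \<open>Writing \<open>k\<close> zeros followed by \<open>v\<close> shrinks a point \<open>y\<close> of the cylinder of \<open>v\<close> by \<open>\<beta> ^ k\<close>. For
  large \<open>k\<close> the result fits into the image of the cylinder of \<open>u\<close>, which contains an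
  interval starting at \<open>0\<close>.\<close>

lemma admissible_join:
  assumes u: "u \<in> admissible" and v: "v \<in> admissible"
  shows "\<exists>g. g \<noteq> [] \<and> u @ g @ v \<in> admissible"
proof -
  obtain t where t: "base_value u < t" "cylinder u = {base_value u..<t}"
    using cylinder_interval[OF u] by blast
  obtain y where y: "y \<in> cylinder v"
    using v by (auto simp: admissible_def)
  then have y01: "0 \<le> y" "y < 1"
    using cylinder_subset by force+
  \<comment> \<open>The number of zeros is a successor, so that the gap is nonempty.\<close>
  obtain k0 where k0: "1 / (t - base_value u) < \<beta> ^ k0"
    using real_arch_pow[OF beta] by blast
  define k where "k = Suc k0"
  define m where "m = length u + k"
  have "1 / (t - base_value u) < \<beta> ^ m"
    using k0 power_increasing[of k0 m \<beta>] beta by (simp add: m_def k_def)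
  then have small: "1 / \<beta> ^ m < t - base_value u"
    using t(1) beta_pos by (simp add: field_simps)
  have zeros: "x / \<beta> ^ j \<in> cylinder (replicate j 0)" if "0 \<le> x" "x < 1" for x j
  proof (induction j)
    case 0
    then show ?case using that by simp
  next
    case (Suc j)
    have "1 \<le> \<beta> ^ Suc j"
      using beta by (intro one_le_power) simp
    then have "x / \<beta> ^ Suc j < 1"
      using that by (subst divide_less_eq_1_pos) linarith+
    moreover have "\<beta> * (x / \<beta> ^ Suc j) = x / \<beta> ^ j"
      using beta by simp
    ultimately show ?case
      using Suc that beta_pos by (simp del: power_Suc)
  qed
  define z where "z = base_value u + y / \<beta> ^ m"
  have "y / \<beta> ^ m \<le> 1 / \<beta> ^ m"
    using y01 beta_pos by (intro divide_right_mono) auto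
  then have "z \<in> cylinder u"
    using small y01 beta_pos by (auto simp: t(2) z_def)
  moreover have "\<beta> ^ length u * (z - base_value u) = y / \<beta> ^ k"
    using beta by (simp add: z_def m_def power_add)
  \<comment> \<open>The subtracted \<open>0\<close> is the value of the block of zeros.\<close>
  moreover have "\<beta> ^ k * (y / \<beta> ^ k - 0) = y"
    using beta by simp
  ultimately have "z \<in> cylinder (u @ replicate k 0 @ v)"
    using zeros[OF y01, of k] y by (simp add: cylinder_append base_value_zeros)
  then show ?thesis
    by (intro exI[of _ "replicate k 0"]) (auto simp: admissible_def k_def)
qed

lemma admissible_letters:
  assumes "u \<in> admissible"
  shows "set u \<subseteq> {a. real a < \<beta>}"
proof -
  have "set u \<subseteq> {a. real a < \<beta>}" if "x \<in> cylinder u" for x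
    using that
  proof (induction u arbitrary: x)
    case (Cons a u)
    then have "\<beta> * x - real a \<in> cylinder u" and "x < 1"
      by auto
    then have "real a \<le> \<beta> * x"
      using cylinder_subset by force
    also have "\<beta> * x < \<beta>"
      using \<open>x < 1\<close> beta by simp
    finally show ?case
      using Cons by auto
  qed simp
  then show ?thesis
    using assms by (auto simp: admissible_def)
qed

lemma finite_letters: "finite {a. real a < \<beta>}"
proof (rule finite_subset)
  show "{a. real a < \<beta>} \<subseteq> {..nat \<lceil>\<beta>\<rceil>}"
    by (auto simp: le_nat_iff) linarith
qed simp

lemma finite_admissible_of_length: "finite (admissible_of_length n)"
proof (rule finite_subset)
  show "admissible_of_length n \<subseteq> {u. set u \<subseteq> {a. real a < \<beta>} \<and> length u = n}"
    using admissible_letters by (auto simp: admissible_of_length_def)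
qed (rule finite_lists_length_eq[OF finite_letters])

section \<open>Counting admissible words\<close>

lemma cylinder_covers:
  assumes "x \<in> {0..<1}"
  shows "\<exists>u. length u = n \<and> x \<in> cylinder u"
  using assms
proof (induction n arbitrary: x)
  case (Suc n)
  define a where "a = nat \<lfloor>\<beta> * x\<rfloor>"
  have "0 \<le> \<beta> * x"
    using Suc.prems beta_pos by simp
  then have "\<beta> * x - real a \<in> {0..<1}"
    by (simp add: a_def) linarith
  then obtain u where "length u = n" "\<beta> * x - real a \<in> cylinder u"
    using Suc.IH by blast
  then show ?case
    using Suc.prems by (intro exI[of _ "a # u"]) auto
qed simp

lemma cylinder_unique:
  assumes "length u = length v" "x \<in> cylinder u" "x \<in> cylinder v"
  shows "u = v"
  using assms
proof (induction u v arbitrary: x rule: list_induct2)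
  case (Cons a u b v)
  then have *: "\<beta> * x - real a \<in> cylinder u" "\<beta> * x - real b \<in> cylinder v"
    by auto
  then have "\<beta> * x - real a \<in> {0..<1}" "\<beta> * x - real b \<in> {0..<1}"
    using cylinder_subset by blast+
  then have "a = b"
    by simp
  then show ?case
    using Cons.IH * by blast
qed simp

text \<open>Every point of \<open>[0,1)\<close> has exactly one code, so the cylinders of the words of length \<open>n\<close>
  partition \<open>[0,1)\<close>. Both counting bounds compare this total length with \<open>\<beta> ^ - n\<close>.\<close>

lemma sum_measure_cylinders:
  "(\<Sum>u\<in>admissible_of_length n. measure lborel (cylinder u)) = 1"
proof -
  have union: "(\<Union>u\<in>admissible_of_length n. cylinder u) = {0..<1}"
    using cylinder_covers[of _ n] cylinder_subset
    by (fastforce simp: admissible_of_length_def admissible_def)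
  have "disjoint_family_on cylinder (admissible_of_length n)"
    unfolding disjoint_family_on_def admissible_of_length_def
    using cylinder_unique by fastforce
  moreover have "emeasure lborel (cylinder u) \<noteq> \<infinity>" for u
  proof -
    have "emeasure lborel (cylinder u) \<le> emeasure lborel {0..<1::real}"
      by (intro emeasure_mono cylinder_subset) simp
    then show ?thesis
      by (auto simp: top_unique)
  qed
  ultimately have "measure lborel (\<Union>u\<in>admissible_of_length n. cylinder u)
      = (\<Sum>u\<in>admissible_of_length n. measure lborel (cylinder u))"
    using cylinder_measurable finite_admissible_of_length
    by (intro measure_finite_Union) auto
  then show ?thesis
    by (simp add: union)
qed

lemma measure_cylinder_le:
  assumes "u \<in> admissible"
  shows "measure lborel (cylinder u) \<le> 1 / \<beta> ^ length u"
  using cylinder_interval[OF assms] by auto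

lemma card_admissible_ge: "\<beta> ^ n \<le> real (card (admissible_of_length n))"
proof -
  have "1 = (\<Sum>u\<in>admissible_of_length n. measure lborel (cylinder u))"
    by (rule sum_measure_cylinders[symmetric])
  also have "\<dots> \<le> (\<Sum>u\<in>admissible_of_length n. 1 / \<beta> ^ n)"
    using measure_cylinder_le by (intro sum_mono) (auto simp: admissible_of_length_def)
  finally show ?thesis
    using beta_pos by (simp add: field_simps)
qed

definition full :: "nat list \<Rightarrow> bool" where
  "full u \<longleftrightarrow> measure lborel (cylinder u) = 1 / \<beta> ^ length u"

lemma card_full_le: "real (card {u \<in> admissible_of_length n. full u}) \<le> \<beta> ^ n"
proof -
  let ?F = "{u \<in> admissible_of_length n. full u}"
  have "real (card ?F) / \<beta> ^ n = (\<Sum>u\<in>?F. measure lborel (cylinder u))"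
    by (simp add: full_def admissible_of_length_def)
  also have "\<dots> \<le> (\<Sum>u\<in>admissible_of_length n. measure lborel (cylinder u))"
    using finite_admissible_of_length by (intro sum_mono2) auto
  also have "\<dots> = 1"
    by (rule sum_measure_cylinders)
  finally show ?thesis
    using beta_pos by (simp add: field_simps)
qed

text \<open>The value of \<open>u @ [b]\<close> lies in the interval of \<open>u\<close>. To its left, that interval contains
  the whole stretch of length \<open>\<beta> ^ - (length u + 1)\<close> on which the next digit is \<open>a\<close>: nothing cuts
  this stretch off.\<close>

lemma full_if_not_largest:
  assumes b: "u @ [b] \<in> admissible" and "a < b"
  shows "full (u @ [a])"
proof -
  have "u \<in> admissible"
    using admissible_factor[of "[]" u "[b]"] b by simp
  then obtain t where t: "t \<le> base_value u + 1 / \<beta> ^ length u" "cylinder u = {base_value u..<t}"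
    using cylinder_interval by blast
  let ?d = "1 / \<beta> ^ Suc (length u)"
  let ?l = "base_value u + real a * ?d"
  have "base_value (u @ [b]) \<in> cylinder (u @ [b])"
    using cylinder_interval[OF b] by force
  then have "base_value (u @ [b]) < t"
    unfolding cylinder_append t(2) by simp
  moreover have "base_value (u @ [b]) = base_value u + real b * ?d"
    unfolding base_value_append by simp
  ultimately have "base_value u + real b * ?d < t"
    by (simp only:)
  moreover have "real (Suc a) * ?d \<le> real b * ?d"
    using \<open>a < b\<close> beta_pos by (intro mult_right_mono) auto
  ultimately have lt: "?l + ?d < t"
    unfolding of_nat_Suc distrib_right by linarith
  have "x \<in> cylinder (u @ [a]) \<longleftrightarrow> x \<in> {?l..<?l + ?d}" for x
  proof -
    \<comment> \<open>\<open>y\<close> is the point that remains to be coded after \<open>u\<close>.\<close>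
    define y where "y = \<beta> ^ length u * (x - base_value u)"
    have x: "x = base_value u + y / \<beta> ^ length u"
      using beta by (simp add: y_def)
    have l: "?l \<le> x \<longleftrightarrow> real a \<le> \<beta> * y" and r: "x < ?l + ?d \<longleftrightarrow> \<beta> * y < real a + 1"
    proof -
      have d: "0 < ?d"
        using beta_pos by simp
      have x': "x = base_value u + (\<beta> * y) * ?d"
        using beta by (simp add: x)
      have e: "?l + ?d = base_value u + (real a + 1) * ?d"
        by (simp only: distrib_right mult_1_left add.assoc)
      show "?l \<le> x \<longleftrightarrow> real a \<le> \<beta> * y"
        unfolding x' add_le_cancel_left mult_le_cancel_right_pos[OF d] ..
      show "x < ?l + ?d \<longleftrightarrow> \<beta> * y < real a + 1"
        unfolding e x' add_less_cancel_left mult_less_cancel_right_pos[OF d] ..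
    qed
    have "y \<in> {0..<1}" if "x \<in> cylinder u"
    proof -
      have "0 \<le> y / \<beta> ^ length u \<and> y / \<beta> ^ length u < 1 / \<beta> ^ length u"
        using that t(1) x unfolding t(2) atLeastLessThan_iff by linarith
      then show ?thesis
        using beta_pos by (auto simp: field_simps)
    qed
    then have "x \<in> cylinder (u @ [a]) \<longleftrightarrow> x \<in> cylinder u \<and> x \<in> {?l..<?l + ?d}"
      unfolding cylinder_append y_def[symmetric] atLeastLessThan_iff l r by auto
    moreover have "x \<in> cylinder u" if "x \<in> {?l..<?l + ?d}"
    proof -
      have "0 \<le> real a * ?d"
        using beta_pos by simp
      then show ?thesis
        using that lt unfolding t(2) atLeastLessThan_iff by linarith
    qed
    ultimately show ?thesis by blast
  qed
  then have "cylinder (u @ [a]) = {?l..<?l + ?d}"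
    by blast
  then show ?thesis
    using beta_pos by (simp add: full_def)
qed

text \<open>Two distinct admissible one-letter extensions of a word are never both non-full, so deleting the
  last letter embeds the admissible non-full words of length \<open>n + 1\<close> into the admissible words of length \<open>n\<close>.\<close>

lemma card_admissible_Suc_le:
  "real (card (admissible_of_length (Suc n))) \<le> real (card (admissible_of_length n)) + \<beta> ^ Suc n"
proof -
  let ?S = "admissible_of_length (Suc n)"
  let ?N = "{u \<in> ?S. \<not> full u}"
  have snoc: "\<exists>u a. w = u @ [a]" if "w \<in> ?S" for w
    using that by (cases w rule: rev_cases) (auto simp: admissible_of_length_def)
  have "inj_on butlast ?N"
  proof (rule inj_onI)
    fix w w' assume w: "w \<in> ?N" "w' \<in> ?N" and eq: "butlast w = butlast w'"
    obtain u a u' b where uv: "w = u @ [a]" "w' = u' @ [b]"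
      using snoc w by blast
    with eq have "w' = u @ [b]" by simp
    then show "w = w'"
      using w uv full_if_not_largest[of u a b] full_if_not_largest[of u b a]
      by (auto simp: admissible_of_length_def) (metis linorder_neqE_nat)
  qed
  moreover have "butlast ` ?N \<subseteq> admissible_of_length n"
  proof
    fix u assume "u \<in> butlast ` ?N"
    then obtain a where "u @ [a] \<in> ?S"
      using snoc by force
    then show "u \<in> admissible_of_length n"
      using admissible_factor[of "[]" u "[a]"] by (auto simp: admissible_of_length_def)
  qed
  ultimately have "card ?N \<le> card (admissible_of_length n)"
    using card_inj_on_le finite_admissible_of_length by blast
  moreover have "card ?S = card ?N + card {u \<in> ?S. full u}"
  proof -
    have "?S = ?N \<union> {u \<in> ?S. full u}" by blast
    moreover have "card (?N \<union> {u \<in> ?S. full u}) = card ?N + card {u \<in> ?S. full u}"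
      using finite_admissible_of_length by (intro card_Un_disjoint) auto
    ultimately show ?thesis by simp
  qed
  ultimately show ?thesis
    using card_full_le[of "Suc n"] by linarith
qed

lemma card_admissible_le:
  "real (card (admissible_of_length n)) \<le> 1 / (1 - 1 / \<beta>) * \<beta> ^ n"
proof -
  have "real (card (admissible_of_length n)) \<le> (\<Sum>i\<le>n. \<beta> ^ i)"
  proof (induction n)
    case 0
    have "admissible_of_length 0 = {[]}"
      using Nil_admissible by (auto simp: admissible_of_length_def)
    then show ?case by simp
  next
    case (Suc n)
    then show ?case
      using card_admissible_Suc_le[of n] by simp
  qed
  also have "\<dots> = (\<beta> ^ Suc n - 1) / (\<beta> - 1)"
    using beta by (simp add: geometric_sum lessThan_Suc_atMost[symmetric] del: power_Suc sum.lessThan_Suc)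
  also have "\<dots> \<le> \<beta> ^ Suc n / (\<beta> - 1)"
    using beta by (intro divide_right_mono) auto
  also have "\<dots> = 1 / (1 - 1 / \<beta>) * \<beta> ^ n"
    using beta by (simp add: field_simps)
  finally show ?thesis .
qed

lemma word_with_admissible_factors:
  "\<exists>w. range w \<subseteq> {a. real a < \<beta>} \<and> (\<forall>n. complexity w n = card (admissible_of_length n))"
proof -
  have "\<exists>w. \<forall>u. factor u w \<longleftrightarrow> u \<in> admissible"
  proof (rule irreducible_language_word)
    show "admissible \<noteq> {}"
      using Nil_admissible by blast
  qed (fact admissible_factor, fact admissible_join)
  then obtain w where w: "\<And>u. factor u w \<longleftrightarrow> u \<in> admissible"
    by blast
  have "real (w i) < \<beta>" for i
  proof -
    have "[w i] = w [i \<rightarrow> Suc i]"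
      unfolding subsequence_def by simp
    then have "factor [w i] w"
      unfolding factor_def by (intro exI[of _ i] exI[of _ "Suc i"]) simp
    then show ?thesis
      using w admissible_letters by fastforce
  qed
  moreover have "{u. length u = n \<and> factor u w} = admissible_of_length n" for n
    by (auto simp: w admissible_of_length_def)
  ultimately show ?thesis
    unfolding complexity_def by (intro exI[of _ w]) auto
qed

end

section \<open>Words of exponential complexity\<close>

theorem theorem8p1:
  shows "\<exists>C :: real \<Rightarrow> real.
    C \<in> {0<..} \<rightarrow> {1..} \<and> antimono_on {0<..} C \<and>
    (\<forall>h \<in> {0<..}. \<exists>(A :: nat set) (w :: nat word).
       finite A \<and> range w \<subseteq> A \<and>
       (\<forall>n :: nat. exp (h * real n) \<le> real (complexity w n) \<and>
                   real (complexity w n) \<le> C h * exp (h * real n)))"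
proof (rule exI[of _ "\<lambda>h. 1 / (1 - 1 / exp h)"], intro conjI ballI)
  let ?C = "\<lambda>h :: real. 1 / (1 - 1 / exp h)"
  have less1: "1 / exp h < 1" if "0 < h" for h :: real
    using that by simp
  show "?C \<in> {0<..} \<rightarrow> {1..}"
    using less1 by (auto simp: le_divide_eq)
  show "antimono_on {0<..} ?C"
  proof (rule monotone_onI)
    fix g h :: real
    assume "g \<in> {0<..}" "h \<in> {0<..}" "g \<le> h"
    moreover from this have "1 / exp h \<le> 1 / exp g"
      by (intro frac_le) auto
    ultimately show "?C h \<le> ?C g"
      using less1[of g] less1[of h] by (intro divide_left_mono mult_pos_pos) auto
  qed
  fix h :: real
  assume "h \<in> {0<..}"
  then have h: "1 < exp h" by simp
  obtain w where w: "range w \<subseteq> {a. real a < exp h}"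
    "\<And>n. complexity w n = card (admissible_of_length (exp h) n)"
    using word_with_admissible_factors[OF h] by blast
  have e: "exp (h * real n) = exp h ^ n" for n
    by (metis exp_of_nat2_mult)
  show "\<exists>(A :: nat set) (w :: nat word). finite A \<and> range w \<subseteq> A \<and>
       (\<forall>n :: nat. exp (h * real n) \<le> real (complexity w n) \<and>
                   real (complexity w n) \<le> ?C h * exp (h * real n))"
    using finite_letters[OF h] w card_admissible_ge[OF h] card_admissible_le[OF h]
    unfolding e by (intro exI[of _ "{a. real a < exp h}"] exI[of _ w]) simp
qed

end
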